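(* Fix integers $n\ge 1$ and degrees $m=(m_1,\ldots,m_{n+1})$ with each $m_j\ge 1$, and fix a $p$-norm. There exist positive scalars $c_m$ and $c_m'$, depending only on the degrees (and $n$) and on the choice of norm, such that the following holds. Let $f:[0,1]^{n+1}\to\mathbb{R}^n$ be a polynomial of degrees $m$ that is nondegenerate, i.e., there is no $x\in[0,1]^{n+1}$ with $f(x)=0$ and $\operatorname{rank}(f'(x))<n$. Then: (1) every polynomial $\tilde f$ of degrees $m$ satisfying $$\frac{\|\tilde f-f\|}{\|f\|}\le \frac{c_m}{\kappa(f)}$$ is nondegenerate; (2) conversely, there exists a degenerate polynomial $\hat f$ of degrees $m$ such that $$\frac{\|\hat f-f\|}{\|f\|}\le \frac{c_m'}{\kappa(f)}.$$
   Context: A polynomial $g:[0,1]^{n+1}\to\mathbb{R}^n$ of degrees $m=(m_1,\ldots,m_{n+1})$ is written in tensor-product Bernstein–Bézier form $g(x)=\sum_{i_1=0}^{m_1}\cdots\sum_{i_{n+1}=0}^{m_{n+1}} b_{i_1,\ldots,i_{n+1}} Z_{i_1,m_1}(x_1)\cdots Z_{i_{n+1},m_{n+1}}(x_{n+1})$ with control points $b_{i_1,\ldots,i_{n+1}}\in\mathbb{R}^n$, where $Z_{i,m}(t)=\frac{m!}{i!(m-i)!}(1-t)^{m-i}t^i$. The norm $\|g\|$ of such a polynomial is the maximum of the chosen $p$-norm of its control points. Matrix norms are the induced operator norms. For an $n\times(n+1)$ matrix $A$ of rank $n$, $A^\dagger=A^T(AA^T)^{-1}$. The condition number is $$\kappa(f)=\|f\|\cdot\max_{x\in[0,1]^{n+1}}\min\left\{\frac{1}{\|f(x)\|},\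 \|f'(x)^\dagger\|\right\},$$ where $1/\|f(x)\|$ is taken to be $\infty$ if $f(x)=0$, and $\|f'(x)^\dagger\|$ is taken to be $\infty$ if $\operatorname{rank}(f'(x))<n$. A polynomial is degenerate if there is $x\in[0,1]^{n+1}$ with $f(x)=0$ and $\operatorname{rank}(f'(x))<n$. *)

theory Defs
  imports "HOL-Analysis.Analysis" "HOL-Library.Extended_Real"
begin

text \<open>Conventions. R^n is real^'n for a finite type 'n (n = CARD('n) >= 1);
  R^(n+1) is real^('n option) (CARD('n option) = n + 1).
  A polynomial of degrees m is given by its array of control points
  b :: ('n option => nat) => real^'n, read only on the multi-indices
  i with i j <= m j for all j.  The p-norm parameter p is an extended
  real with 1 <= p (p = infinity allowed).\<close>

definition pnorm :: "ereal \<Rightarrow> real^'k \<Rightarrow> real" where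
  "pnorm p v = (if p = \<infinity> then Max (range (\<lambda>j. \<bar>v $ j\<bar>))
                else (\<Sum>j\<in>UNIV. \<bar>v $ j\<bar> powr real_of_ereal p) powr (1 / real_of_ereal p))"

definition bern :: "nat \<Rightarrow> nat \<Rightarrow> real \<Rightarrow> real" where
  "bern i m t = real (m choose i) * (1 - t) ^ (m - i) * t ^ i"

definition multi_idx :: "('j \<Rightarrow> nat) \<Rightarrow> ('j \<Rightarrow> nat) set" where
  "multi_idx m = {i. \<forall>j. i j \<le> m j}"

text \<open>Evaluation of the tensor-product Bernstein--Bezier polynomial.\<close>
definition bb_eval :: "('n option \<Rightarrow> nat) \<Rightarrow> (('n option \<Rightarrow> nat) \<Rightarrow> real^'n)
                        \<Rightarrow> real^('n::finite option) \<Rightarrow> real^'n" where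
  "bb_eval m b x = (\<Sum>i\<in>multi_idx m. (\<Prod>j\<in>UNIV. bern (i j) (m j) (x $ j)) *\<^sub>R b i)"

text \<open>Norm of a polynomial: maximum of the p-norms of its control points.\<close>
definition bb_norm :: "ereal \<Rightarrow> ('n option \<Rightarrow> nat) \<Rightarrow> (('n option \<Rightarrow> nat) \<Rightarrow> real^'n)
                        \<Rightarrow> real" where
  "bb_norm p m b = Max ((\<lambda>i. pnorm p (b i)) ` multi_idx (m :: 'n::finite option \<Rightarrow> nat))"

definition unit_cube :: "(real^'k) set" where
  "unit_cube = {x. \<forall>j. 0 \<le> x $ j \<and> x $ j \<le> 1}"

text \<open>Jacobian f'(x), an n x (n+1) matrix: entry (k,j) is the partial
  derivative of component k with respect to x_j.\<close>
definition bb_jac :: "('n option \<Rightarrow> nat) \<Rightarrow> (('n option \<Rightarrow> nat) \<Rightarrow> real^'n)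
                        \<Rightarrow> real^('n::finite option) \<Rightarrow> real^('n option)^'n" where
  "bb_jac m b x = (\<chi> k j. deriv (\<lambda>t. bb_eval m b (\<chi> l. if l = j then t else x $ l) $ k) (x $ j))"

text \<open>Moore--Penrose pseudoinverse of a full-row-rank matrix.\<close>
definition pinv :: "real^'c^'r \<Rightarrow> real^'r^'c" where
  "pinv A = transpose A ** matrix_inv (A ** transpose A)"

text \<open>Induced operator norm w.r.t. the p-norms.\<close>
definition opnorm :: "ereal \<Rightarrow> real^'c^'r \<Rightarrow> real" where
  "opnorm p M = (SUP y\<in>{y. y \<noteq> 0}. pnorm p (M *v y) / pnorm p y)"

definition degenerate :: "('n option \<Rightarrow> nat) \<Rightarrow> (('n option \<Rightarrow> nat) \<Rightarrow> real^'n) \<Rightarrow> bool" where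
  "degenerate m b \<longleftrightarrow> (\<exists>x\<in>unit_cube. bb_eval m b x = 0 \<and>
                         rank (bb_jac m b x) < CARD('n::finite))"

text \<open>Condition number (as an extended real).\<close>
definition kappa :: "ereal \<Rightarrow> ('n option \<Rightarrow> nat) \<Rightarrow> (('n option \<Rightarrow> nat) \<Rightarrow> real^'n) \<Rightarrow> ereal" where
  "kappa p m b = ereal (bb_norm p m b) *
     (SUP x\<in>unit_cube.
        min (if bb_eval m b x = 0 then \<infinity> else ereal (1 / pnorm p (bb_eval m b x)))
            (if rank (bb_jac m b x) < CARD('n::finite) then \<infinity>
             else ereal (opnorm p (pinv (bb_jac m b x)))))"

end

theory Submission
  imports Defs
begin

text \<open>The condition number is \<open>\<parallel>f\<parallel>\<close> times the supremum over the cube of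
  \<open>\<mu>(x) = min (1 / \<parallel>f(x)\<parallel>) \<parallel>f'(x)\<^sup>\<dagger>\<parallel>\<close>; each point has a neighbourhood on which \<open>\<mu>\<close> is bounded
  unless \<open>f\<close> is degenerate there, so by compactness \<open>\<kappa>(f)\<close> is finite for nondegenerate \<open>f\<close>.
  Values and Jacobians depend linearly on the control points, with constants depending only
  on \<open>m\<close>. If \<open>g\<close> is degenerate at \<open>x\<close> and \<open>\<delta> = \<parallel>g - f\<parallel>\<close>, then either \<open>\<parallel>f(x)\<parallel> = O(\<delta>)\<close>, or
  a left kernel vector of \<open>g'(x)\<close> shows \<open>\<parallel>f'(x)\<^sup>\<dagger>\<parallel> \<ge> 1 / O(\<delta>)\<close>; either way \<open>\<mu>(x) \<ge> 1 / O(\<delta>)\<close>,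
  which is (1). Conversely, at a point where \<open>\<mu>\<close> is at least half its supremum, subtract
  from \<open>f\<close> an affine map that cancels \<open>f(x)\<close> and turns \<open>f'(x)\<close> into a nearby rank deficient matrix
  (a rank-one update of size \<open>O(1 / \<parallel>f'(x)\<^sup>\<dagger>\<parallel>)\<close>). By linear precision of the Bernstein basis
  this affine map has degrees \<open>m\<close>, with control points of size \<open>O(1 / \<mu>(x))\<close>, which gives (2).\<close>

section \<open>p-norms and operator norms\<close>

lemma abs_component_le_pnorm:
  fixes v :: "real^'k"
  assumes "p \<ge> 1"
  shows "\<bar>v $ j\<bar> \<le> pnorm p v"
proof (cases "p = \<infinity>")
  case True
  then show ?thesis unfolding pnorm_def by (auto intro: Max_ge)
next
  case False
  define q where "q = real_of_ereal p"
  have q: "q \<ge> 1" using assms False unfolding q_def by (cases p) auto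
  have "\<bar>v $ j\<bar> powr q \<le> (\<Sum>l\<in>UNIV. \<bar>v $ l\<bar> powr q)"
    by (rule member_le_sum) auto
  then have "(\<bar>v $ j\<bar> powr q) powr (1/q) \<le> (\<Sum>l\<in>UNIV. \<bar>v $ l\<bar> powr q) powr (1/q)"
    by (intro powr_mono2) (use q in auto)
  moreover have "(\<bar>v $ j\<bar> powr q) powr (1/q) = \<bar>v $ j\<bar>"
    using q by (simp add: powr_powr)
  ultimately show ?thesis using False unfolding pnorm_def q_def by simp
qed

lemma pnorm_le_card_mult:
  fixes v :: "real^'k"
  assumes "p \<ge> 1" and M: "\<And>j. \<bar>v $ j\<bar> \<le> M"
  shows "pnorm p v \<le> real CARD('k) * M"
proof -
  have M0: "M \<ge> 0" using M[of undefined] by linarith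
  have card: "real CARD('k) \<ge> 1" by simp
  show ?thesis
  proof (cases "p = \<infinity>")
    case True
    have "Max (range (\<lambda>j. \<bar>v $ j\<bar>)) \<le> M" using M by (auto intro!: Max.boundedI)
    also have "M \<le> real CARD('k) * M" using card M0 by (simp add: mult_le_cancel_right1)
    finally show ?thesis using True unfolding pnorm_def by simp
  next
    case False
    define q where "q = real_of_ereal p"
    have q: "q \<ge> 1" using assms False unfolding q_def by (cases p) auto
    have "(\<Sum>l\<in>UNIV. \<bar>v $ l\<bar> powr q) \<le> (\<Sum>l\<in>(UNIV::'k set). M powr q)"
      by (intro sum_mono powr_mono2) (use q M in auto)
    then have "(\<Sum>l\<in>UNIV. \<bar>v $ l\<bar> powr q) powr (1/q) \<le> (real CARD('k) * M powr q) powr (1/q)"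
      by (intro powr_mono2) (use q in \<open>auto intro: sum_nonneg\<close>)
    also have "\<dots> = real CARD('k) powr (1/q) * M"
      using q M0 by (simp add: powr_mult powr_powr)
    also have "\<dots> \<le> real CARD('k) powr 1 * M"
      by (intro mult_right_mono powr_mono) (use q card M0 in auto)
    finally show ?thesis using False unfolding pnorm_def q_def by simp
  qed
qed

lemma pnorm_le_card_norm:
  fixes v :: "real^'k"
  assumes "p \<ge> 1"
  shows "pnorm p v \<le> real CARD('k) * norm v"
  by (rule pnorm_le_card_mult[OF assms]) (simp add: component_le_norm_cart)

lemma norm_le_card_pnorm:
  fixes v :: "real^'k"
  assumes "p \<ge> 1"
  shows "norm v \<le> real CARD('k) * pnorm p v"
proof -
  have "norm v \<le> (\<Sum>j\<in>UNIV. \<bar>v $ j\<bar>)" by (rule norm_le_l1_cart)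
  also have "\<dots> \<le> (\<Sum>j\<in>(UNIV::'k set). pnorm p v)"
    by (intro sum_mono abs_component_le_pnorm assms)
  finally show ?thesis by simp
qed

lemma pnorm_nonneg:
  fixes v :: "real^'k"
  assumes "p \<ge> 1"
  shows "pnorm p v \<ge> 0"
  using abs_component_le_pnorm[OF assms, of v undefined] by linarith

lemma pnorm_pos:
  fixes v :: "real^'k"
  assumes "p \<ge> 1" "v \<noteq> 0"
  shows "pnorm p v > 0"
proof -
  have "0 < norm v" using assms(2) by simp
  also have "\<dots> \<le> real CARD('k) * pnorm p v" by (rule norm_le_card_pnorm[OF assms(1)])
  finally show ?thesis by (simp add: zero_less_mult_iff)
qed

lemma card_le_card_option: "real CARD('n::finite) \<le> real CARD('n option)"
  by (simp add: card_option)

lemma norm_matrix_vector_le: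
  fixes M :: "real^'c^'r"
  assumes "\<And>k j. \<bar>M $ k $ j\<bar> \<le> e"
  shows "norm (M *v y) \<le> real CARD('r) * real CARD('c) * e * norm y"
proof -
  have "norm (M *v y) \<le> onorm ((*v) M) * norm y" by (rule onorm) simp
  also have "\<dots> \<le> real CARD('r) * real CARD('c) * e * norm y"
    by (intro mult_right_mono onorm_le_matrix_component assms) simp
  finally show ?thesis .
qed

lemma opnorm_bdd_above:
  fixes M :: "real^'c^'r"
  assumes p: "p \<ge> 1"
  shows "bdd_above ((\<lambda>y. pnorm p (M *v y) / pnorm p y) ` {y. y \<noteq> 0})"
proof -
  define K where "K = onorm ((*v) M)"
  have "pnorm p (M *v y) / pnorm p y \<le> real CARD('r) * K * real CARD('c)" if "y \<noteq> 0" for y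
  proof -
    have "pnorm p (M *v y) \<le> real CARD('r) * norm (M *v y)" by (rule pnorm_le_card_norm[OF p])
    also have "\<dots> \<le> real CARD('r) * (K * norm y)"
      unfolding K_def by (intro mult_left_mono onorm) auto
    also have "\<dots> \<le> real CARD('r) * (K * (real CARD('c) * pnorm p y))"
      unfolding K_def by (intro mult_left_mono norm_le_card_pnorm p onorm_pos_le) auto
    finally show ?thesis using pnorm_pos[OF p that] by (simp add: divide_le_eq algebra_simps)
  qed
  then show ?thesis by (auto simp: bdd_above_def)
qed

lemma ratio_le_opnorm:
  fixes M :: "real^'c^'r"
  assumes p: "p \<ge> 1" and "y \<noteq> 0"
  shows "pnorm p (M *v y) / pnorm p y \<le> opnorm p M"
  unfolding opnorm_def by (rule cSUP_upper[OF _ opnorm_bdd_above[OF p]]) (use assms in auto)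

lemma ex_nonzero_vec: "\<exists>y::real^'c. y \<noteq> 0"
  by (rule exI[of _ "axis undefined 1"]) (simp add: axis_eq_0_iff)

lemma opnorm_le:
  fixes M :: "real^'c^'r"
  assumes p: "p \<ge> 1" and K: "\<And>y. pnorm p (M *v y) \<le> K * pnorm p y"
  shows "opnorm p M \<le> K"
  unfolding opnorm_def
proof (rule cSUP_least)
  show "{y::real^'c. y \<noteq> 0} \<noteq> {}" using ex_nonzero_vec by auto
  fix y :: "real^'c"
  assume "y \<in> {y. y \<noteq> 0}"
  then show "pnorm p (M *v y) / pnorm p y \<le> K"
    using K[of y] pnorm_pos[OF p, of y] by (simp add: divide_le_eq)
qed

lemma less_opnorm_imp_ratio:
  fixes M :: "real^'c^'r"
  assumes p: "p \<ge> 1" and "r < opnorm p M"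
  obtains y where "y \<noteq> 0" "r < pnorm p (M *v y) / pnorm p y"
proof -
  have "{y::real^'c. y \<noteq> 0} \<noteq> {}" using ex_nonzero_vec by auto
  then show ?thesis
    using assms(2) that less_cSUP_iff[OF _ opnorm_bdd_above[OF p]] unfolding opnorm_def by blast
qed

section \<open>Rank deficiency and the pseudoinverse\<close>

lemma rank_less_card_rows_iff:
  fixes A :: "real^'c^'r"
  shows "rank A < CARD('r) \<longleftrightarrow> \<not> inj ((*v) (transpose A))"
  using less_rank_noninjective[of "transpose A"] rank_transpose[of A] by simp

lemma inj_matrix_vector_iff:
  fixes B :: "real^'c^'r"
  shows "inj ((*v) B) \<longleftrightarrow> (\<forall>w. B *v w = 0 \<longrightarrow> w = 0)"
  by (rule linear_inj_iff_eq_0[OF matrix_vector_mul_linear])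

lemma bounded_below_imp_inj:
  fixes B :: "real^'c^'r"
  assumes "s > 0" "\<And>w. s * norm w \<le> norm (B *v w)"
  shows "inj ((*v) B)"
  unfolding inj_matrix_vector_iff
proof (intro allI impI)
  fix w
  assume "B *v w = 0"
  then have "s * norm w \<le> 0" using assms(2)[of w] by simp
  then show "w = 0" using assms(1) by (simp add: mult_le_0_iff)
qed

lemma matrix_inv_right:
  fixes G :: "real^'n^'n"
  assumes "invertible G"
  shows "G ** matrix_inv G = mat 1"
proof -
  have "\<exists>G'. G ** G' = mat 1 \<and> G' ** G = mat 1" using assms unfolding invertible_def by blast
  then show ?thesis unfolding matrix_inv_def by (rule someI2_ex) blast
qed

lemma inner_matrix_vector_transpose:
  fixes A :: "real^'c^'r"
  shows "w \<bullet> (A *v z) = (transpose A *v w) \<bullet> z"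
  by (simp add: dot_lmul_matrix)

lemma inner_gram:
  fixes A :: "real^'c^'r"
  shows "w \<bullet> ((A ** transpose A) *v w) = (transpose A *v w) \<bullet> (transpose A *v w)"
  by (simp only: matrix_vector_mul_assoc[symmetric] inner_matrix_vector_transpose)

lemma invertible_gram:
  fixes A :: "real^'c^'r"
  assumes inj: "inj ((*v) (transpose A))"
  shows "invertible (A ** transpose A)"
proof -
  have "w = 0" if "(A ** transpose A) *v w = 0" for w
  proof -
    have "transpose A *v w = 0" using inner_gram[of w A] that by simp
    then show ?thesis using inj unfolding inj_matrix_vector_iff by blast
  qed
  then show ?thesis
    unfolding invertible_left_inverse matrix_left_invertible_ker by blast
qed

lemma pinv_right_inverse:
  fixes A :: "real^'c^'r"
  assumes "inj ((*v) (transpose A))"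
  shows "A ** pinv A = mat 1"
  unfolding pinv_def using matrix_inv_right[OF invertible_gram[OF assms]]
  by (simp add: matrix_mul_assoc)

text \<open>Take \<open>u = (A A\<^sup>T)\<^sup>-\<^sup>1 y\<close>; then \<open>\<parallel>pinv A y\<parallel>\<^sup>2 = u \<bullet> y\<close>.\<close>

lemma pinv_mult_vector_factor:
  fixes A :: "real^'c^'r"
  assumes "inj ((*v) (transpose A))"
  obtains u where "pinv A *v y = transpose A *v u" "(norm (pinv A *v y))\<^sup>2 \<le> norm u * norm y"
proof
  define u where "u = matrix_inv (A ** transpose A) *v y"
  show z: "pinv A *v y = transpose A *v u"
    unfolding u_def pinv_def by (simp add: matrix_vector_mul_assoc)
  have "(A ** transpose A) *v u = y"
    unfolding u_def by (simp add: matrix_vector_mul_assoc matrix_inv_right[OF invertible_gram[OF assms]])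
  then have "(norm (pinv A *v y))\<^sup>2 = u \<bullet> y"
    using inner_gram[of u A] by (simp add: z power2_norm_eq_inner)
  also have "\<dots> \<le> norm u * norm y" by (rule Cauchy_Schwarz_ineq2[THEN order.trans[OF abs_ge_self]])
  finally show "(norm (pinv A *v y))\<^sup>2 \<le> norm u * norm y" .
qed

lemma norm_pinv_mult_le:
  fixes A :: "real^'c^'r"
  assumes s: "s > 0" and low: "\<And>w. s * norm w \<le> norm (transpose A *v w)"
  shows "s * norm (pinv A *v y) \<le> norm y"
proof -
  obtain u where z: "pinv A *v y = transpose A *v u" and zz: "(norm (pinv A *v y))\<^sup>2 \<le> norm u * norm y"
    using pinv_mult_vector_factor[OF bounded_below_imp_inj[OF s low]] by blast
  have "s * norm u * norm (pinv A *v y) \<le> norm u * norm y"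
  proof -
    have "s * norm u * norm (pinv A *v y) \<le> norm (pinv A *v y) * norm (pinv A *v y)"
      using low[of u] unfolding z by (intro mult_right_mono) auto
    then show ?thesis using zz by (simp add: power2_eq_square)
  qed
  then show ?thesis
    using s z by (cases "u = 0") (auto simp: mult.assoc)
qed

lemma opnorm_pinv_le:
  fixes A :: "real^'c^'r"
  assumes p: "p \<ge> 1" and s: "s > 0" and low: "\<And>w. s * norm w \<le> norm (transpose A *v w)"
  shows "opnorm p (pinv A) \<le> real CARD('c) * real CARD('r) / s"
proof (rule opnorm_le[OF p])
  fix y :: "real^'r"
  have "pnorm p (pinv A *v y) \<le> real CARD('c) * norm (pinv A *v y)"
    by (rule pnorm_le_card_norm[OF p])
  also have "\<dots> \<le> real CARD('c) * (norm y / s)"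
    using norm_pinv_mult_le[OF s low, of y] s by (intro mult_left_mono) (auto simp: field_simps)
  also have "\<dots> \<le> real CARD('c) * (real CARD('r) * pnorm p y / s)"
    by (intro mult_left_mono divide_right_mono norm_le_card_pnorm p) (use s in auto)
  finally show "pnorm p (pinv A *v y) \<le> real CARD('c) * real CARD('r) / s * pnorm p y"
    by simp
qed

lemma opnorm_pinv_pos:
  fixes A :: "real^'c^'r"
  assumes p: "p \<ge> 1" and inj: "inj ((*v) (transpose A))"
  shows "opnorm p (pinv A) > 0"
proof -
  obtain y :: "real^'r" where y: "y \<noteq> 0" using ex_nonzero_vec by blast
  have "A *v (pinv A *v y) = y"
    by (simp add: matrix_vector_mul_assoc pinv_right_inverse[OF inj])
  then have "pinv A *v y \<noteq> 0" using y by auto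
  then have "0 < pnorm p (pinv A *v y) / pnorm p y"
    using pnorm_pos[OF p] y by (metis divide_pos_pos)
  also have "\<dots> \<le> opnorm p (pinv A)" by (rule ratio_le_opnorm[OF p y])
  finally show ?thesis .
qed

lemma bounded_below_perturb:
  fixes A A' :: "real^'c^'r"
  assumes low: "\<And>w. s * norm w \<le> norm (transpose A *v w)"
    and close: "\<And>k j. \<bar>A' $ k $ j - A $ k $ j\<bar> \<le> e"
  shows "(s - real CARD('r) * real CARD('c) * e) * norm w \<le> norm (transpose A' *v w)"
proof -
  have "transpose A *v w = transpose A' *v w - (transpose A' - transpose A) *v w"
    by (simp add: matrix_vector_mult_diff_rdistrib)
  then have "norm (transpose A *v w)
      \<le> norm (transpose A' *v w) + norm ((transpose A' - transpose A) *v w)"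
    by (metis norm_triangle_ineq4)
  moreover have "norm ((transpose A' - transpose A) *v w) \<le> real CARD('c) * real CARD('r) * e * norm w"
    by (rule norm_matrix_vector_le) (simp add: transpose_def close)
  ultimately show ?thesis using low[of w] by (simp add: algebra_simps)
qed

lemma opnorm_pinv_locally_bounded:
  fixes A :: "real^'c^'r"
  assumes p: "p \<ge> 1" and inj: "inj ((*v) (transpose A))"
  obtains e C where "e > 0" "\<And>A'. (\<And>k j. \<bar>A' $ k $ j - A $ k $ j\<bar> \<le> e) \<Longrightarrow>
    inj ((*v) (transpose A')) \<and> opnorm p (pinv A') \<le> C"
proof -
  obtain s where s: "s > 0" "\<And>w. s * norm w \<le> norm (transpose A *v w)"
    using linear_inj_bounded_below_pos[OF matrix_vector_mul_linear inj] by blast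
  define c where "c = real CARD('r) * real CARD('c)"
  have c: "c > 0" by (simp add: c_def)
  define e where "e = s / (2 * c)"
  have e: "e > 0" using s c by (simp add: e_def)
  have "inj ((*v) (transpose A')) \<and> opnorm p (pinv A') \<le> real CARD('c) * real CARD('r) / (s / 2)"
    if close: "\<And>k j. \<bar>A' $ k $ j - A $ k $ j\<bar> \<le> e" for A'
  proof -
    have half: "s - c * e = s / 2" using c unfolding e_def by (simp add: field_simps)
    have low: "s / 2 * norm w \<le> norm (transpose A' *v w)" for w
      using bounded_below_perturb[OF s(2) close, of w] unfolding c_def[symmetric] half .
    show ?thesis using bounded_below_imp_inj[OF _ low] opnorm_pinv_le[OF p _ low] s by simp
  qed
  with e that show ?thesis by blast
qed

text \<open>If \<open>B\<close> is rank deficient, a vector \<open>w\<close> in the left kernel of \<open>B\<close> satisfies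
  \<open>w = A (P w) = (A - B) (P w) + B (P w)\<close> with \<open>w \<bullet> B (P w) = 0\<close>.\<close>

lemma norm_le_perturbation_left_kernel:
  fixes A B :: "real^'c^'r"
  assumes AP: "A ** P = mat 1" and Bw: "transpose B *v w = 0"
  shows "norm w \<le> norm ((A - B) *v (P *v w))"
proof -
  have "w \<bullet> w = w \<bullet> (A *v (P *v w))"
    by (simp add: matrix_vector_mul_assoc AP)
  also have "\<dots> = w \<bullet> ((A - B) *v (P *v w)) + (transpose B *v w) \<bullet> (P *v w)"
    by (simp add: matrix_vector_mult_diff_rdistrib inner_diff_right inner_matrix_vector_transpose)
  also have "\<dots> \<le> norm w * norm ((A - B) *v (P *v w))"
    using Bw Cauchy_Schwarz_ineq2[of w "(A - B) *v (P *v w)"] by simp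
  finally have "norm w * norm w \<le> norm w * norm ((A - B) *v (P *v w))"
    by (simp add: dot_square_norm power2_eq_square)
  then show ?thesis by (cases "w = 0") auto
qed

lemma transpose_diff: "transpose (A - B) = transpose A - transpose (B::real^'c^'r)"
  by (simp add: transpose_def vec_eq_iff)

definition outer :: "real^'r \<Rightarrow> real^'c \<Rightarrow> real^'c^'r" where
  "outer u g = (\<chi> k j. u $ k * g $ j)"

lemma transpose_outer_mult: "transpose (outer u g) *v u = (u \<bullet> u) *\<^sub>R g"
  by (simp add: outer_def vec_eq_iff matrix_vector_mult_def transpose_def inner_vec_def
      sum_distrib_left algebra_simps flip: transpose_matrix_vector)

lemma one_le_entry_dist_mult_opnorm_pinv:
  fixes A B :: "real^'c^'r"
  assumes p: "p \<ge> 1" and inj: "inj ((*v) (transpose A))" and rk: "rank B < CARD('r)"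
    and close: "\<And>k j. \<bar>A $ k $ j - B $ k $ j\<bar> \<le> e"
  shows "1 \<le> (real CARD('r) * real CARD('c))\<^sup>2 * e * opnorm p (pinv A)"
proof -
  define R where "R = real CARD('r)"
  define C where "C = real CARD('c)"
  define P where "P = pinv A"
  have e: "0 \<le> e" using close[of undefined undefined] by linarith
  obtain w where w: "w \<noteq> 0" "transpose B *v w = 0"
    using rk unfolding rank_less_card_rows_iff inj_matrix_vector_iff by blast
  have "norm w \<le> norm ((A - B) *v (P *v w))"
    using norm_le_perturbation_left_kernel[OF pinv_right_inverse[OF inj] w(2)] unfolding P_def .
  also have "\<dots> \<le> R * C * e * norm (P *v w)"
    unfolding R_def C_def by (rule norm_matrix_vector_le) (simp add: close)
  also have "\<dots> \<le> R * C * e * (C * pnorm p (P *v w))"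
    using norm_le_card_pnorm[OF p, of "P *v w"] e unfolding R_def C_def by (intro mult_left_mono) auto
  finally have nw: "norm w \<le> R * C * e * (C * pnorm p (P *v w))" .
  have "pnorm p w \<le> R * norm w" unfolding R_def by (rule pnorm_le_card_norm[OF p])
  also have "\<dots> \<le> R * (R * C * e * (C * pnorm p (P *v w)))"
    using nw unfolding R_def by (intro mult_left_mono) auto
  also have "\<dots> \<le> R * (R * C * e * (C * (opnorm p P * pnorm p w)))"
    using ratio_le_opnorm[OF p w(1), of P] pnorm_pos[OF p w(1)] e unfolding R_def C_def
    by (intro mult_left_mono) (auto simp: divide_le_eq)
  finally have "1 * pnorm p w \<le> ((R * C)\<^sup>2 * e * opnorm p P) * pnorm p w"
    by (simp add: power2_eq_square mult_ac)
  then show ?thesis unfolding R_def C_def P_def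
    by (rule mult_right_le_imp_le) (rule pnorm_pos[OF p w(1)])
qed

text \<open>With \<open>z = pinv A y = A\<^sup>T u\<close>, the update \<open>A - u z\<^sup>T / \<parallel>u\<parallel>\<^sup>2\<close> kills \<open>u\<close> from the left,
  and its size is \<open>\<parallel>z\<parallel> / \<parallel>u\<parallel> \<le> \<parallel>y\<parallel> / \<parallel>z\<parallel>\<close>.\<close>

lemma rank_one_update_singular:
  fixes A :: "real^'c^'r"
  assumes inj: "inj ((*v) (transpose A))" and y: "y \<noteq> 0"
  obtains u g where "rank (A - outer u g) < CARD('r)"
    "norm g * norm u * norm (pinv A *v y) \<le> norm y"
proof -
  define z where "z = pinv A *v y"
  obtain u where zu: "z = transpose A *v u" and zz: "(norm z)\<^sup>2 \<le> norm u * norm y"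
    using pinv_mult_vector_factor[OF inj] unfolding z_def by blast
  have "A *v z = y" by (simp add: z_def matrix_vector_mul_assoc pinv_right_inverse[OF inj])
  then have "z \<noteq> 0" using y by auto
  then have u: "u \<noteq> 0" using zu by auto
  define g where "g = (1 / (u \<bullet> u)) *\<^sub>R z"
  have "transpose (A - outer u g) *v u = 0"
    using u by (simp add: transpose_diff matrix_vector_mult_diff_rdistrib transpose_outer_mult g_def
        flip: zu transpose_matrix_vector)
  then have "rank (A - outer u g) < CARD('r)"
    using u unfolding rank_less_card_rows_iff inj_matrix_vector_iff by blast
  moreover have "norm g * norm u * norm z \<le> norm y"
  proof -
    have "norm g * norm u * norm z = (norm z)\<^sup>2 / norm u"
      using u by (simp add: g_def dot_square_norm power2_eq_square)
    then show ?thesis using zz u by (simp add: divide_le_eq mult.commute)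
  qed
  ultimately show ?thesis using that unfolding z_def by blast
qed

lemma exists_rank_deficient_near:
  fixes A :: "real^'c^'r"
  assumes p: "p \<ge> 1" and inj: "inj ((*v) (transpose A))" and r: "0 < r" "r \<le> opnorm p (pinv A)"
  obtains u g where "rank (A - outer u g) < CARD('r)"
    "r * (norm g * norm u) \<le> 2 * real CARD('r) * real CARD('c)"
proof -
  obtain y where y: "y \<noteq> 0" and ratio: "r / 2 < pnorm p (pinv A *v y) / pnorm p y"
    using less_opnorm_imp_ratio[OF p, of "r / 2" "pinv A"] r by auto
  obtain u g where rk: "rank (A - outer u g) < CARD('r)"
    and gu: "norm g * norm u * norm (pinv A *v y) \<le> norm y"
    using rank_one_update_singular[OF inj y] by blast
  define z where "z = pinv A *v y"
  have py: "pnorm p y > 0" using pnorm_pos[OF p y] .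
  have "r * pnorm p y < 2 * pnorm p z" using ratio py unfolding z_def by (simp add: field_simps)
  also have "\<dots> \<le> 2 * (real CARD('c) * norm z)" using pnorm_le_card_norm[OF p, of z] by simp
  finally have rz: "r * pnorm p y < 2 * real CARD('c) * norm z" by simp
  have "r * (norm g * norm u) * norm z \<le> r * norm y"
    using gu r unfolding z_def by (simp add: mult.assoc)
  also have "\<dots> \<le> r * (real CARD('r) * pnorm p y)"
    using norm_le_card_pnorm[OF p, of y] r by simp
  also have "\<dots> \<le> 2 * real CARD('r) * real CARD('c) * norm z"
    using rz by (simp add: algebra_simps)
  finally have "r * (norm g * norm u) * norm z \<le> 2 * real CARD('r) * real CARD('c) * norm z" .
  moreover have "norm z > 0"
  proof -
    have "0 < 2 * real CARD('c) * norm z" using rz mult_pos_pos[OF r(1) py] by linarith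
    then show ?thesis by (simp add: zero_less_mult_iff)
  qed
  ultimately show ?thesis using that rk by simp
qed

section \<open>Tensor-product Bernstein polynomials\<close>

lemma bern_sum: "(\<Sum>k\<le>m. bern k m t) = 1"
proof -
  have "(t + (1 - t)) ^ m = (\<Sum>k\<le>m. of_nat (m choose k) * t ^ k * (1 - t) ^ (m - k))"
    by (rule binomial_ring)
  then show ?thesis unfolding bern_def by (simp add: algebra_simps)
qed

lemma bern_weighted_sum: "(\<Sum>k\<le>m. real k * bern k m t) = real m * t"
proof (cases m)
  case 0
  then show ?thesis by simp
next
  case (Suc n)
  have "real (Suc k) * bern (Suc k) (Suc n) t = real (Suc n) * t * bern k n t" for k
  proof -
    have e: "real (Suc k) * real (Suc n choose Suc k) = real (Suc n) * real (n choose k)"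
      using Suc_times_binomial[of k n] by (metis of_nat_mult)
    have "real (Suc k) * bern (Suc k) (Suc n) t
        = (real (Suc k) * real (Suc n choose Suc k)) * (1 - t) ^ (n - k) * (t * t ^ k)"
      unfolding bern_def by simp
    also have "\<dots> = real (Suc n) * t * bern k n t" unfolding e bern_def by simp
    finally show ?thesis .
  qed
  then have "(\<Sum>k\<le>Suc n. real k * bern k (Suc n) t) = real (Suc n) * t * (\<Sum>k\<le>n. bern k n t)"
    by (simp add: sum.atMost_Suc_shift sum_distrib_left del: sum.atMost_Suc)
  then show ?thesis using Suc by (simp add: bern_sum)
qed

definition dbern :: "nat \<Rightarrow> nat \<Rightarrow> real \<Rightarrow> real" where
  "dbern i m t = real (m choose i) *
     (real i * (1 - t) ^ (m - i) * t ^ (i - 1) - real (m - i) * (1 - t) ^ (m - i - 1) * t ^ i)"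

lemma bern_has_derivative: "(bern i m has_real_derivative dbern i m t) (at t)"
  unfolding bern_def dbern_def by (auto intro!: derivative_eq_intros simp: algebra_simps)

lemma abs_bern_le:
  assumes "0 \<le> t" "t \<le> 1"
  shows "\<bar>bern i m t\<bar> \<le> real (m choose i)"
proof -
  have "(1 - t) ^ (m - i) * t ^ i \<le> 1" using assms by (intro mult_le_one power_le_one) auto
  then show ?thesis using assms unfolding bern_def by (simp add: mult_left_le mult.assoc)
qed

lemma abs_dbern_le:
  assumes "0 \<le> t" "t \<le> 1" "i \<le> m"
  shows "\<bar>dbern i m t\<bar> \<le> real (m choose i) * real m"
proof -
  define a where "a = real i * ((1 - t) ^ (m - i) * t ^ (i - 1))"
  define a' where "a' = real (m - i) * ((1 - t) ^ (m - i - 1) * t ^ i)"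
  have "(1 - t) ^ (m - i) * t ^ (i - 1) \<le> 1" "(1 - t) ^ (m - i - 1) * t ^ i \<le> 1"
    using assms by (intro mult_le_one power_le_one; simp)+
  then have "0 \<le> a" "a \<le> real i" "0 \<le> a'" "a' \<le> real (m - i)"
    using assms unfolding a_def a'_def by (auto simp: mult_left_le)
  then have "\<bar>a - a'\<bar> \<le> real m" using assms by linarith
  then show ?thesis unfolding dbern_def abs_mult a_def a'_def mult.assoc abs_of_nat
    by (rule mult_left_mono) simp
qed

definition vec_upd :: "real^'k \<Rightarrow> 'k \<Rightarrow> real \<Rightarrow> real^'k" where
  "vec_upd x j t = (\<chi> l. if l = j then t else x $ l)"

definition bern_tensor :: "('j::finite \<Rightarrow> nat) \<Rightarrow> ('j \<Rightarrow> nat) \<Rightarrow> real^'j \<Rightarrow> real" where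
  "bern_tensor m i x = (\<Prod>l\<in>UNIV. bern (i l) (m l) (x $ l))"

definition bern_tensor_partial ::
    "('j::finite \<Rightarrow> nat) \<Rightarrow> ('j \<Rightarrow> nat) \<Rightarrow> real^'j \<Rightarrow> 'j \<Rightarrow> real" where
  "bern_tensor_partial m i x j = (\<Prod>l\<in>UNIV. (if l = j then dbern else bern) (i l) (m l) (x $ l))"

lemma multi_idx_PiE: "multi_idx m = PiE UNIV (\<lambda>j. {..m j})"
  unfolding multi_idx_def by (auto simp: PiE_UNIV_domain)

lemma finite_multi_idx: "finite (multi_idx (m :: 'j::finite \<Rightarrow> nat))"
  unfolding multi_idx_PiE by (intro finite_PiE) auto

lemma zero_in_multi_idx: "(\<lambda>_. 0) \<in> multi_idx m"
  unfolding multi_idx_def by auto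

lemma bb_eval_component: "bb_eval m b x $ k = (\<Sum>i\<in>multi_idx m. bern_tensor m i x * b i $ k)"
  unfolding bb_eval_def bern_tensor_def by (simp add: sum_component)

lemma bern_tensor_vec_upd:
  "bern_tensor m i (vec_upd x j t) = bern (i j) (m j) t * (\<Prod>l\<in>UNIV-{j}. bern (i l) (m l) (x $ l))"
proof -
  have "bern_tensor m i (vec_upd x j t)
      = bern (i j) (m j) t * (\<Prod>l\<in>UNIV-{j}. bern (i l) (m l) (vec_upd x j t $ l))"
    unfolding bern_tensor_def by (subst prod.remove[of _ j]) (auto simp: vec_upd_def)
  also have "(\<Prod>l\<in>UNIV-{j}. bern (i l) (m l) (vec_upd x j t $ l)) = (\<Prod>l\<in>UNIV-{j}. bern (i l) (m l) (x $ l))"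
    by (rule prod.cong) (auto simp: vec_upd_def)
  finally show ?thesis .
qed

lemma bern_tensor_partial_eq:
  "bern_tensor_partial m i x j = dbern (i j) (m j) (x $ j) * (\<Prod>l\<in>UNIV-{j}. bern (i l) (m l) (x $ l))"
  unfolding bern_tensor_partial_def by (subst prod.remove[of _ j]) (auto intro!: prod.cong)

lemma bb_jac_eq_sum: "bb_jac m b x $ k $ j = (\<Sum>i\<in>multi_idx m. bern_tensor_partial m i x j * b i $ k)"
proof -
  have "bb_jac m b x $ k $ j = deriv (\<lambda>t. bb_eval m b (vec_upd x j t) $ k) (x $ j)"
    unfolding bb_jac_def vec_upd_def by simp
  also have "\<dots> = (\<Sum>i\<in>multi_idx m. bern_tensor_partial m i x j * b i $ k)"
    unfolding bb_eval_component bern_tensor_vec_upd bern_tensor_partial_eq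
    by (rule DERIV_imp_deriv) (auto intro!: derivative_eq_intros bern_has_derivative)
  finally show ?thesis .
qed

lemma bern_tensor_sum: "(\<Sum>i\<in>multi_idx m. bern_tensor m i x) = 1"
proof -
  have "(\<Prod>l\<in>UNIV. \<Sum>k\<in>{..m l}. bern k (m l) (x $ l))
      = (\<Sum>g\<in>PiE UNIV (\<lambda>l. {..m l}). \<Prod>l\<in>UNIV. bern (g l) (m l) (x $ l))"
    by (rule prod_sum_PiE) auto
  then show ?thesis unfolding multi_idx_PiE bern_tensor_def by (simp add: bern_sum)
qed

lemma bern_tensor_weighted_sum:
  "(\<Sum>i\<in>multi_idx m. real (i j) * bern_tensor m i x) = real (m j) * x $ j"
proof -
  define f where "f l k = (if l = j then real k else 1) * bern k (m l) (x $ l)" for l k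
  have "(\<Prod>l\<in>UNIV. \<Sum>k\<in>{..m l}. f l k) = (\<Sum>g\<in>PiE UNIV (\<lambda>l. {..m l}). \<Prod>l\<in>UNIV. f l (g l))"
    by (rule prod_sum_PiE) auto
  moreover have "(\<Prod>l\<in>UNIV. \<Sum>k\<in>{..m l}. f l k) = (\<Prod>l\<in>UNIV. if l = j then real (m j) * x $ j else 1)"
    by (rule prod.cong) (auto simp: f_def bern_sum bern_weighted_sum)
  moreover have "(\<Prod>l\<in>UNIV. f l (g l)) = real (g j) * bern_tensor m g x" for g
    unfolding f_def bern_tensor_def prod.distrib by (subst prod.delta) auto
  ultimately show ?thesis unfolding multi_idx_PiE by (simp add: prod.delta)
qed

lemma bb_eval_diff: "bb_eval m (\<lambda>i. b i - b' i) x = bb_eval m b x - bb_eval m b' x"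
  unfolding bb_eval_def by (simp add: scaleR_diff_right sum_subtractf)

lemma bb_jac_diff: "bb_jac m (\<lambda>i. b i - b' i) x = bb_jac m b x - bb_jac m b' x"
  by (simp add: vec_eq_iff bb_jac_eq_sum algebra_simps sum_subtractf)

lemma isCont_bb_eval: "isCont (bb_eval m b) y"
  unfolding bb_eval_def bern_def by (auto intro!: continuous_intros)

lemma isCont_bb_jac: "isCont (bb_jac m b) y"
proof -
  have "bb_jac m b = (\<lambda>x. \<chi> k j. \<Sum>i\<in>multi_idx m. bern_tensor_partial m i x j * b i $ k)"
    by (simp add: fun_eq_iff vec_eq_iff bb_jac_eq_sum)
  then show ?thesis
    unfolding isCont_def bern_tensor_partial_def dbern_def bern_def
    by (auto intro!: tendsto_intros)
qed

lemma unit_cube_cbox: "unit_cube = cbox (0::real^'k) 1"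
  unfolding unit_cube_def by (auto simp: mem_box_cart)

lemma zero_in_unit_cube: "0 \<in> unit_cube"
  unfolding unit_cube_def by simp

definition bern_weight :: "('j::finite \<Rightarrow> nat) \<Rightarrow> ('j \<Rightarrow> nat) \<Rightarrow> real" where
  "bern_weight m i = (\<Prod>l\<in>UNIV. real (m l choose i l) * (1 + real (m l)))"

definition bern_bound :: "('j::finite \<Rightarrow> nat) \<Rightarrow> real" where
  "bern_bound m = (\<Sum>i\<in>multi_idx m. bern_weight m i)"

lemma bern_bound_pos: "0 < bern_bound m"
proof -
  have "0 < bern_weight m (\<lambda>_. 0)" unfolding bern_weight_def by (simp add: prod_pos add_pos_nonneg)
  also have "\<dots> \<le> bern_bound m"
    unfolding bern_bound_def
    by (rule member_le_sum[OF zero_in_multi_idx _ finite_multi_idx]) (simp add: bern_weight_def prod_nonneg)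
  finally show ?thesis .
qed

lemma abs_bern_tensor_le:
  assumes "x \<in> unit_cube"
  shows "\<bar>bern_tensor m i x\<bar> \<le> bern_weight m i"
  unfolding bern_tensor_def bern_weight_def abs_prod
proof (rule prod_mono)
  fix l
  have "\<bar>bern (i l) (m l) (x $ l)\<bar> \<le> real (m l choose i l)"
    using assms by (intro abs_bern_le) (auto simp: unit_cube_def)
  also have "\<dots> \<le> real (m l choose i l) * (1 + real (m l))" by (simp add: distrib_left)
  finally show "0 \<le> \<bar>bern (i l) (m l) (x $ l)\<bar> \<and> \<bar>bern (i l) (m l) (x $ l)\<bar> \<le> \<dots>" by simp
qed

lemma abs_bern_tensor_partial_le:
  assumes "x \<in> unit_cube" "i \<in> multi_idx m"
  shows "\<bar>bern_tensor_partial m i x j\<bar> \<le> bern_weight m i"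
  unfolding bern_tensor_partial_def bern_weight_def abs_prod
proof (rule prod_mono)
  fix l
  have x: "0 \<le> x $ l" "x $ l \<le> 1" and i: "i l \<le> m l"
    using assms by (auto simp: unit_cube_def multi_idx_def)
  have "\<bar>dbern (i l) (m l) (x $ l)\<bar> \<le> real (m l choose i l) * (1 + real (m l))"
    using abs_dbern_le[OF x i] by (simp add: distrib_left)
  moreover have "\<bar>bern (i l) (m l) (x $ l)\<bar> \<le> real (m l choose i l) * (1 + real (m l))"
    using abs_bern_le[OF x, of "i l" "m l"] by (simp add: distrib_left add_increasing2)
  ultimately show "0 \<le> \<bar>(if l = j then dbern else bern) (i l) (m l) (x $ l)\<bar> \<and>
      \<bar>(if l = j then dbern else bern) (i l) (m l) (x $ l)\<bar> \<le> real (m l choose i l) * (1 + real (m l))"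
    by (cases "l = j") simp_all
qed

lemma norm_bb_eval_le:
  assumes "x \<in> unit_cube" "\<And>i. i \<in> multi_idx m \<Longrightarrow> norm (b i) \<le> E"
  shows "norm (bb_eval m b x) \<le> bern_bound m * E"
proof -
  have "norm (bb_eval m b x) \<le> (\<Sum>i\<in>multi_idx m. \<bar>bern_tensor m i x\<bar> * norm (b i))"
    unfolding bb_eval_def bern_tensor_def[symmetric] by (rule norm_sum[THEN order.trans]) simp
  also have "\<dots> \<le> (\<Sum>i\<in>multi_idx m. bern_weight m i * E)"
    using assms by (intro sum_mono mult_mono abs_bern_tensor_le) (auto simp: bern_weight_def prod_nonneg)
  finally show ?thesis by (simp add: bern_bound_def sum_distrib_right)
qed

lemma abs_bb_jac_le:
  assumes "x \<in> unit_cube" "\<And>i. i \<in> multi_idx m \<Longrightarrow> norm (b i) \<le> E"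
  shows "\<bar>bb_jac m b x $ k $ j\<bar> \<le> bern_bound m * E"
proof -
  have "\<bar>bb_jac m b x $ k $ j\<bar> \<le> (\<Sum>i\<in>multi_idx m. \<bar>bern_tensor_partial m i x j\<bar> * \<bar>b i $ k\<bar>)"
    unfolding bb_jac_eq_sum abs_mult[symmetric] by (rule sum_abs)
  also have "\<dots> \<le> (\<Sum>i\<in>multi_idx m. bern_weight m i * E)"
    using assms
    by (intro sum_mono mult_mono abs_bern_tensor_partial_le order.trans[OF component_le_norm_cart])
      (auto simp: bern_weight_def prod_nonneg)
  finally show ?thesis by (simp add: bern_bound_def sum_distrib_right)
qed

text \<open>Linear precision of the Bernstein basis: the polynomial whose control points are the values of
  an affine map at the Greville abscissae is that affine map.\<close>

definition greville :: "('j::finite \<Rightarrow> nat) \<Rightarrow> ('j \<Rightarrow> nat) \<Rightarrow> real^'j" where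
  "greville m i = (\<chi> j. real (i j) / real (m j))"

lemma bern_tensor_sum_inner_greville:
  assumes m: "\<forall>j. m j \<ge> 1"
  shows "(\<Sum>i\<in>multi_idx m. bern_tensor m i y * (g \<bullet> (greville m i - x))) = g \<bullet> (y - x)"
proof -
  have "(\<Sum>i\<in>multi_idx m. bern_tensor m i y * (g \<bullet> (greville m i - x)))
      = (\<Sum>j\<in>UNIV. g $ j / real (m j) * (\<Sum>i\<in>multi_idx m. real (i j) * bern_tensor m i y)
                    - g $ j * x $ j * (\<Sum>i\<in>multi_idx m. bern_tensor m i y))"
    unfolding inner_vec_def greville_def
    by (simp add: sum_distrib_left sum_distrib_right sum_subtractf algebra_simps sum.swap[of _ UNIV])
  also have "\<dots> = (\<Sum>j\<in>UNIV. g $ j * (y $ j - x $ j))"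
  proof (rule sum.cong)
    fix j
    have "real (m j) \<noteq> 0" using m by (metis not_one_le_zero of_nat_0_eq_iff)
    then show "g $ j / real (m j) * (\<Sum>i\<in>multi_idx m. real (i j) * bern_tensor m i y)
        - g $ j * x $ j * (\<Sum>i\<in>multi_idx m. bern_tensor m i y) = g $ j * (y $ j - x $ j)"
      by (simp add: bern_tensor_weighted_sum bern_tensor_sum field_simps)
  qed simp
  finally show ?thesis by (simp add: inner_vec_def)
qed

lemma bb_eval_affine:
  assumes "\<forall>j. m j \<ge> 1"
  shows "bb_eval m (\<lambda>i. c + (g \<bullet> (greville m i - x)) *\<^sub>R u) y = c + (g \<bullet> (y - x)) *\<^sub>R u"
proof -
  have "bb_eval m (\<lambda>i. c + (g \<bullet> (greville m i - x)) *\<^sub>R u) y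
      = (\<Sum>i\<in>multi_idx m. bern_tensor m i y) *\<^sub>R c
        + (\<Sum>i\<in>multi_idx m. bern_tensor m i y * (g \<bullet> (greville m i - x))) *\<^sub>R u"
    unfolding bb_eval_def bern_tensor_def[symmetric]
    by (simp add: scaleR_add_right sum.distrib scaleR_sum_left)
  then show ?thesis unfolding bern_tensor_sum bern_tensor_sum_inner_greville[OF assms] by simp
qed

lemma bb_jac_affine:
  assumes "\<forall>j. m j \<ge> 1"
  shows "bb_jac m (\<lambda>i. c + (g \<bullet> (greville m i - x)) *\<^sub>R u) x = outer u g"
proof -
  have "g \<bullet> (vec_upd x j t - x) = g $ j * (t - x $ j)" for j t
  proof -
    have "g \<bullet> (vec_upd x j t - x) = (\<Sum>l\<in>UNIV. if l = j then g $ j * (t - x $ j) else 0)"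
      unfolding inner_vec_def by (rule sum.cong) (auto simp: vec_upd_def)
    then show ?thesis by simp
  qed
  then have "bb_jac m (\<lambda>i. c + (g \<bullet> (greville m i - x)) *\<^sub>R u) x $ k $ j
      = deriv (\<lambda>t. c $ k + g $ j * (t - x $ j) * u $ k) (x $ j)" for k j
    unfolding bb_jac_def vec_upd_def[symmetric] bb_eval_affine[OF assms] by simp
  also have "deriv (\<lambda>t. c $ k + g $ j * (t - x $ j) * u $ k) (x $ j) = u $ k * g $ j" for k j
    by (rule DERIV_imp_deriv) (auto intro!: derivative_eq_intros)
  finally show ?thesis by (simp add: vec_eq_iff outer_def)
qed

lemma norm_greville_diff_le:
  fixes m :: "'j::finite \<Rightarrow> nat"
  assumes m: "\<forall>j. m j \<ge> 1" and i: "i \<in> multi_idx m" and x: "x \<in> unit_cube"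
  shows "norm (greville m i - x) \<le> real CARD('j)"
proof -
  have "\<bar>(greville m i - x) $ j\<bar> \<le> 1" for j
  proof -
    have "0 \<le> real (i j) / real (m j)" "real (i j) / real (m j) \<le> 1"
      using m i by (auto simp: multi_idx_def divide_le_eq_1 dest: spec[of _ j])
    moreover have "0 \<le> x $ j" "x $ j \<le> 1" using x by (auto simp: unit_cube_def)
    ultimately have "\<bar>real (i j) / real (m j) - x $ j\<bar> \<le> 1" unfolding abs_le_iff by linarith
    then show ?thesis by (simp add: greville_def)
  qed
  then have "norm (greville m i - x) \<le> (\<Sum>j\<in>(UNIV::'j set). 1)"
    by (intro order.trans[OF norm_le_l1_cart] sum_mono)
  then show ?thesis by simp
qed

lemma norm_affine_at_greville_le:
  fixes m :: "'j::finite \<Rightarrow> nat"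
  assumes m: "\<forall>j. m j \<ge> 1" and i: "i \<in> multi_idx m" and x: "x \<in> unit_cube"
  shows "norm (c + (g \<bullet> (greville m i - x)) *\<^sub>R u) \<le> norm c + real CARD('j) * (norm g * norm u)"
proof -
  have "\<bar>g \<bullet> (greville m i - x)\<bar> \<le> norm g * norm (greville m i - x)"
    by (rule Cauchy_Schwarz_ineq2)
  also have "\<dots> \<le> norm g * real CARD('j)"
    using norm_greville_diff_le[OF m i x] by (intro mult_left_mono) auto
  finally have "\<bar>g \<bullet> (greville m i - x)\<bar> * norm u \<le> norm g * real CARD('j) * norm u"
    by (rule mult_right_mono) simp
  moreover have "norm (c + (g \<bullet> (greville m i - x)) *\<^sub>R u) \<le> norm c + \<bar>g \<bullet> (greville m i - x)\<bar> * norm u"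
    using norm_triangle_ineq[of c "(g \<bullet> (greville m i - x)) *\<^sub>R u"] by simp
  ultimately show ?thesis by (simp add: mult_ac)
qed

lemma pnorm_le_bb_norm: "i \<in> multi_idx m \<Longrightarrow> pnorm p (b i) \<le> bb_norm p m b"
  unfolding bb_norm_def by (rule Max_ge) (use finite_multi_idx in auto)

lemma bb_norm_le:
  "(\<And>i. i \<in> multi_idx m \<Longrightarrow> pnorm p (b i) \<le> X) \<Longrightarrow> bb_norm p m b \<le> X"
  unfolding bb_norm_def using finite_multi_idx zero_in_multi_idx by (subst Max_le_iff) auto

lemma bb_norm_nonneg: "p \<ge> 1 \<Longrightarrow> bb_norm p m b \<ge> 0"
  using pnorm_le_bb_norm[OF zero_in_multi_idx] pnorm_nonneg by (meson order.trans)

lemma norm_le_bb_norm: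
  fixes b :: "('n::finite option \<Rightarrow> nat) \<Rightarrow> real^'n"
  assumes p: "p \<ge> 1" and "i \<in> multi_idx m"
  shows "norm (b i) \<le> real CARD('n) * bb_norm p m b"
  using norm_le_card_pnorm[OF p, of "b i"] pnorm_le_bb_norm[OF assms(2), of p b]
  by (meson mult_left_mono of_nat_0_le_iff order.trans)

lemma norm_bb_eval_diff_le:
  fixes b b' :: "('n::finite option \<Rightarrow> nat) \<Rightarrow> real^'n"
  assumes "p \<ge> 1" "x \<in> unit_cube"
  shows "norm (bb_eval m b' x - bb_eval m b x)
    \<le> bern_bound m * (real CARD('n) * bb_norm p m (\<lambda>i. b' i - b i))"
proof -
  have "norm (bb_eval m (\<lambda>i. b' i - b i) x)
      \<le> bern_bound m * (real CARD('n) * bb_norm p m (\<lambda>i. b' i - b i))"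
    by (rule norm_bb_eval_le[OF assms(2) norm_le_bb_norm[OF assms(1)]])
  then show ?thesis by (simp add: bb_eval_diff)
qed

lemma abs_bb_jac_diff_le:
  fixes b b' :: "('n::finite option \<Rightarrow> nat) \<Rightarrow> real^'n"
  assumes "p \<ge> 1" "x \<in> unit_cube"
  shows "\<bar>(bb_jac m b' x - bb_jac m b x) $ k $ j\<bar>
    \<le> bern_bound m * (real CARD('n) * bb_norm p m (\<lambda>i. b' i - b i))"
proof -
  have "\<bar>bb_jac m (\<lambda>i. b' i - b i) x $ k $ j\<bar>
      \<le> bern_bound m * (real CARD('n) * bb_norm p m (\<lambda>i. b' i - b i))"
    by (rule abs_bb_jac_le[OF assms(2) norm_le_bb_norm[OF assms(1)]])
  then show ?thesis by (simp add: bb_jac_diff)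
qed

lemma bb_norm_pos:
  fixes b :: "('n::finite option \<Rightarrow> nat) \<Rightarrow> real^'n"
  assumes p: "p \<ge> 1" and nd: "\<not> degenerate m b"
  shows "bb_norm p m b > 0"
proof (rule ccontr)
  assume "\<not> bb_norm p m b > 0"
  then have "b i = 0" if "i \<in> multi_idx m" for i
    using pnorm_le_bb_norm[OF that, of p b] pnorm_pos[OF p] by force
  then have "bb_eval m b 0 = 0" "bb_jac m b 0 = 0"
    by (simp_all add: bb_eval_def vec_eq_iff bb_jac_eq_sum)
  then show False using nd zero_in_unit_cube unfolding degenerate_def by force
qed

section \<open>The local condition number\<close>

definition cond_at :: "ereal \<Rightarrow> ('n::finite option \<Rightarrow> nat) \<Rightarrow> (('n option \<Rightarrow> nat) \<Rightarrow> real^'n)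
    \<Rightarrow> real^'n option \<Rightarrow> ereal" where
  "cond_at p m b x =
     min (if bb_eval m b x = 0 then \<infinity> else ereal (1 / pnorm p (bb_eval m b x)))
         (if rank (bb_jac m b x) < CARD('n) then \<infinity> else ereal (opnorm p (pinv (bb_jac m b x))))"

lemma kappa_eq_SUP_cond_at:
  fixes b :: "('n::finite option \<Rightarrow> nat) \<Rightarrow> real^'n"
  shows "kappa p m b = ereal (bb_norm p m b) * (SUP x\<in>unit_cube. cond_at p m b x)"
  unfolding kappa_def cond_at_def ..

lemma cond_at_le_ereal_iff:
  fixes b :: "('n::finite option \<Rightarrow> nat) \<Rightarrow> real^'n"
  shows "cond_at p m b x \<le> ereal r \<longleftrightarrow>
     (bb_eval m b x \<noteq> 0 \<and> 1 / pnorm p (bb_eval m b x) \<le> r) \<or>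
     (\<not> rank (bb_jac m b x) < CARD('n) \<and> opnorm p (pinv (bb_jac m b x)) \<le> r)"
  unfolding cond_at_def by (auto simp: min_le_iff_disj)

lemma ereal_le_cond_at_iff:
  fixes b :: "('n::finite option \<Rightarrow> nat) \<Rightarrow> real^'n"
  shows "ereal r \<le> cond_at p m b x \<longleftrightarrow>
     (bb_eval m b x \<noteq> 0 \<longrightarrow> r \<le> 1 / pnorm p (bb_eval m b x)) \<and>
     (\<not> rank (bb_jac m b x) < CARD('n) \<longrightarrow> r \<le> opnorm p (pinv (bb_jac m b x)))"
  unfolding cond_at_def by auto

lemma cond_at_pos:
  fixes b :: "('n::finite option \<Rightarrow> nat) \<Rightarrow> real^'n"
  assumes "p \<ge> 1"
  shows "0 < cond_at p m b x"
  unfolding cond_at_def using pnorm_pos[OF assms, of "bb_eval m b x"] opnorm_pinv_pos[OF assms, of "bb_jac m b x"]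
  by (auto simp: rank_less_card_rows_iff)

lemma cond_at_locally_bounded:
  fixes b :: "('n::finite option \<Rightarrow> nat) \<Rightarrow> real^'n"
  assumes p: "p \<ge> 1" and nd: "\<not> degenerate m b" and y: "y \<in> unit_cube"
  shows "\<exists>C. eventually (\<lambda>x. cond_at p m b x \<le> ereal C) (nhds y)"
proof (cases "bb_eval m b y = 0")
  case False
  define e where "e = norm (bb_eval m b y) / 2"
  have e: "e > 0" using False by (simp add: e_def)
  have "eventually (\<lambda>x. dist (bb_eval m b x) (bb_eval m b y) < e) (nhds y)"
    using isCont_bb_eval[where m=m and b=b and y=y] e
    unfolding isCont_def tendsto_at_iff_tendsto_nhds by (rule tendstoD)
  moreover have "cond_at p m b x \<le> ereal (real CARD('n) / e)"
    if "dist (bb_eval m b x) (bb_eval m b y) < e" for x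
  proof -
    have "e < norm (bb_eval m b x)"
      using that norm_triangle_ineq2[of "bb_eval m b y" "bb_eval m b x"]
      by (simp add: e_def dist_norm norm_minus_commute)
    also have "\<dots> \<le> real CARD('n) * pnorm p (bb_eval m b x)" by (rule norm_le_card_pnorm[OF p])
    finally have "e < real CARD('n) * pnorm p (bb_eval m b x)" .
    moreover have f: "bb_eval m b x \<noteq> 0" using \<open>e < norm (bb_eval m b x)\<close> e by auto
    ultimately have "1 / pnorm p (bb_eval m b x) \<le> real CARD('n) / e"
      using e pnorm_pos[OF p f] by (simp add: field_simps)
    then show ?thesis using f by (simp add: cond_at_le_ereal_iff)
  qed
  ultimately show ?thesis by (blast intro: eventually_mono)
next
  case True
  define A where "A = bb_jac m b y"
  have "\<not> rank A < CARD('n)" using nd y True unfolding degenerate_def A_def by auto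
  then obtain e C where e: "e > 0" and C: "\<And>A'. (\<And>k j. \<bar>A' $ k $ j - A $ k $ j\<bar> \<le> e) \<Longrightarrow>
      \<not> rank A' < CARD('n) \<and> opnorm p (pinv A') \<le> C"
    using opnorm_pinv_locally_bounded[OF p] unfolding rank_less_card_rows_iff by metis
  have "eventually (\<lambda>x. dist (bb_jac m b x) A < e) (nhds y)"
    using isCont_bb_jac[where m=m and b=b and y=y] e
    unfolding isCont_def tendsto_at_iff_tendsto_nhds A_def by (rule tendstoD)
  moreover have "cond_at p m b x \<le> ereal C" if "dist (bb_jac m b x) A < e" for x
  proof -
    have "\<bar>bb_jac m b x $ k $ j - A $ k $ j\<bar> \<le> e" for k j
      using that order.trans[OF component_le_norm_cart Finite_Cartesian_Product.norm_nth_le,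
          of "bb_jac m b x - A" k j]
      by (simp add: dist_norm)
    then show ?thesis using C by (simp add: cond_at_le_ereal_iff)
  qed
  ultimately show ?thesis by (blast intro: eventually_mono)
qed

lemma SUP_less_top_if_locally_bounded:
  fixes g :: "'a::topological_space \<Rightarrow> ereal"
  assumes K: "compact K" and loc: "\<And>y. y \<in> K \<Longrightarrow> \<exists>C. eventually (\<lambda>x. g x \<le> ereal C) (nhds y)"
  shows "(SUP x\<in>K. g x) < \<infinity>"
proof -
  have "\<forall>y\<in>K. \<exists>U C. open U \<and> y \<in> U \<and> (\<forall>x\<in>U. g x \<le> ereal C)"
    using loc unfolding eventually_nhds by blast
  then obtain U C where U: "\<And>y. y \<in> K \<Longrightarrow> open (U y) \<and> y \<in> U y \<and> (\<forall>x\<in>U y. g x \<le> ereal (C y))"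
    by metis
  obtain T where T: "T \<subseteq> K" "finite T" "K \<subseteq> (\<Union>y\<in>T. U y)"
    using compactE_image[OF K, of K U] U by blast
  have "g x \<le> ereal (Max (insert 0 (C ` T)))" if x: "x \<in> K" for x
  proof -
    obtain y where y: "y \<in> T" "x \<in> U y" using T x by blast
    then have "g x \<le> ereal (C y)" using U T by blast
    also have "C y \<le> Max (insert 0 (C ` T))" using y T by simp
    finally show ?thesis by simp
  qed
  then have "(SUP x\<in>K. g x) \<le> ereal (Max (insert 0 (C ` T)))" by (rule SUP_least)
  then show ?thesis by (rule order.strict_trans1) simp
qed

lemma SUP_cond_at_less_top:
  fixes b :: "('n::finite option \<Rightarrow> nat) \<Rightarrow> real^'n"
  assumes "p \<ge> 1" "\<not> degenerate m b"
  shows "(SUP x\<in>unit_cube. cond_at p m b x) < \<infinity>"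
  using compact_cbox cond_at_locally_bounded[OF assms]
  by (intro SUP_less_top_if_locally_bounded) (auto simp: unit_cube_cbox)

section \<open>Distance to the degenerate polynomials\<close>

lemma pnorm_bb_eval_le_dist:
  fixes b b' :: "('n::finite option \<Rightarrow> nat) \<Rightarrow> real^'n"
  assumes p: "p \<ge> 1" and x: "x \<in> unit_cube" and f': "bb_eval m b' x = 0"
  shows "pnorm p (bb_eval m b x)
    \<le> real CARD('n option) ^ 2 * bern_bound m * bb_norm p m (\<lambda>i. b' i - b i)"
proof -
  define N where "N = real CARD('n option)"
  have "pnorm p (bb_eval m b x) \<le> real CARD('n) * norm (bb_eval m b' x - bb_eval m b x)"
    using pnorm_le_card_norm[OF p, of "bb_eval m b x"] f' by simp
  also have "\<dots> \<le> real CARD('n) * (bern_bound m * (real CARD('n) * bb_norm p m (\<lambda>i. b' i - b i)))"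
    by (intro mult_left_mono norm_bb_eval_diff_le p x) simp
  also have "\<dots> = (real CARD('n) * real CARD('n)) * (bern_bound m * bb_norm p m (\<lambda>i. b' i - b i))"
    by (simp only: mult_ac)
  also have "\<dots> \<le> (N * N) * (bern_bound m * bb_norm p m (\<lambda>i. b' i - b i))"
    using card_le_card_option[where 'n='n] bern_bound_pos[of m] bb_norm_nonneg[OF p, of m]
    unfolding N_def by (intro mult_right_mono mult_mono) auto
  finally show ?thesis by (simp add: N_def power2_eq_square mult_ac)
qed

lemma one_le_dist_mult_opnorm_pinv:
  fixes b b' :: "('n::finite option \<Rightarrow> nat) \<Rightarrow> real^'n"
  assumes p: "p \<ge> 1" and x: "x \<in> unit_cube" and rk': "rank (bb_jac m b' x) < CARD('n)"
    and rk: "\<not> rank (bb_jac m b x) < CARD('n)"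
  shows "1 \<le> real CARD('n option) ^ 5 * bern_bound m * bb_norm p m (\<lambda>i. b' i - b i)
              * opnorm p (pinv (bb_jac m b x))"
proof -
  define N where "N = real CARD('n option)"
  define E where "E = bern_bound m * bb_norm p m (\<lambda>i. b' i - b i) * opnorm p (pinv (bb_jac m b x))"
  have N: "real CARD('n) \<le> N" unfolding N_def by (rule card_le_card_option)
  have E: "0 \<le> E" unfolding E_def
    using bern_bound_pos[of m] bb_norm_nonneg[OF p, of m] opnorm_pinv_pos[OF p, of "bb_jac m b x"] rk
    by (simp add: rank_less_card_rows_iff less_imp_le)
  have "\<bar>bb_jac m b x $ k $ j - bb_jac m b' x $ k $ j\<bar>
      \<le> bern_bound m * (real CARD('n) * bb_norm p m (\<lambda>i. b' i - b i))" for k j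
    using abs_bb_jac_diff_le[OF p x, where b=b and b'=b'] by (simp add: abs_minus_commute)
  then have "1 \<le> (real CARD('n) * N)\<^sup>2 * (bern_bound m * (real CARD('n) * bb_norm p m (\<lambda>i. b' i - b i)))
      * opnorm p (pinv (bb_jac m b x))"
    using one_le_entry_dist_mult_opnorm_pinv[OF p _ rk'] rk unfolding N_def rank_less_card_rows_iff by blast
  also have "\<dots> = ((real CARD('n) * N)\<^sup>2 * real CARD('n)) * E" unfolding E_def by (simp only: mult_ac)
  also have "\<dots> \<le> ((N * N)\<^sup>2 * N) * E"
  proof (rule mult_right_mono[OF _ E])
    have "real CARD('n) * N \<le> N * N" using N unfolding N_def by (intro mult_right_mono) auto
    then have "(real CARD('n) * N)\<^sup>2 \<le> (N * N)\<^sup>2" by (rule power_mono) (simp add: N_def)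
    then show "(real CARD('n) * N)\<^sup>2 * real CARD('n) \<le> (N * N)\<^sup>2 * N"
      using N by (rule mult_mono) auto
  qed
  also have "\<dots> = N ^ 5 * E" by (simp add: eval_nat_numeral mult_ac)
  finally show ?thesis unfolding E_def N_def by (simp only: mult_ac)
qed

lemma one_le_dist_mult_cond_at:
  fixes b b' :: "('n::finite option \<Rightarrow> nat) \<Rightarrow> real^'n"
  assumes p: "p \<ge> 1" and x: "x \<in> unit_cube" and f': "bb_eval m b' x = 0"
    and rk': "rank (bb_jac m b' x) < CARD('n)" and r: "cond_at p m b x \<le> ereal r"
  shows "1 \<le> real CARD('n option) ^ 5 * bern_bound m * bb_norm p m (\<lambda>i. b' i - b i) * r"
proof -
  define N where "N = real CARD('n option)"
  define K where "K = N ^ 5 * bern_bound m * bb_norm p m (\<lambda>i. b' i - b i)"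
  have N: "1 \<le> N" unfolding N_def by simp
  have K: "N ^ 2 * bern_bound m * bb_norm p m (\<lambda>i. b' i - b i) \<le> K"
    unfolding K_def using N bern_bound_pos[of m] bb_norm_nonneg[OF p, of m]
    by (intro mult_right_mono power_increasing) auto
  from r consider
      (val) "bb_eval m b x \<noteq> 0" "1 / pnorm p (bb_eval m b x) \<le> r"
    | (jac) "\<not> rank (bb_jac m b x) < CARD('n)" "opnorm p (pinv (bb_jac m b x)) \<le> r"
    unfolding cond_at_le_ereal_iff by blast
  then show ?thesis
  proof cases
    case val
    have pos: "0 < pnorm p (bb_eval m b x)" by (rule pnorm_pos[OF p val(1)])
    have one: "1 \<le> r * pnorm p (bb_eval m b x)"
      using val(2) pos by (simp add: divide_le_eq)
    have "0 < r * pnorm p (bb_eval m b x)" using one by linarith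
    then have r: "0 < r" using pos zero_less_mult_pos2 by blast
    have "pnorm p (bb_eval m b x) \<le> K"
      using order.trans[OF pnorm_bb_eval_le_dist[OF p x f'] K[unfolded N_def]] unfolding N_def .
    then have "r * pnorm p (bb_eval m b x) \<le> r * K" using r by simp
    with one have "1 \<le> K * r" by (simp add: mult.commute)
    then show ?thesis unfolding K_def N_def .
  next
    case jac
    have "0 \<le> K" unfolding K_def using N bern_bound_pos[of m] bb_norm_nonneg[OF p, of m] by simp
    have "1 \<le> K * opnorm p (pinv (bb_jac m b x))"
      using one_le_dist_mult_opnorm_pinv[OF p x rk' jac(1)] unfolding K_def N_def .
    also have "\<dots> \<le> K * r" by (rule mult_left_mono[OF jac(2) \<open>0 \<le> K\<close>])
    finally show ?thesis unfolding K_def N_def .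
  qed
qed

text \<open>Subtracting from every control point the value at \<open>x\<close> of the affine map
  \<open>y \<mapsto> f(x) + (g \<bullet> (y - x)) u\<close>, sampled at the Greville abscissae, moves \<open>f(x)\<close> to \<open>0\<close>
  and \<open>f'(x)\<close> to \<open>f'(x) - u g\<^sup>T\<close>.\<close>

lemma exists_degenerate_affine_correction:
  fixes b :: "('n::finite option \<Rightarrow> nat) \<Rightarrow> real^'n"
  assumes m: "\<forall>j. m j \<ge> 1" and p: "p \<ge> 1" and x: "x \<in> unit_cube"
    and rk: "rank (bb_jac m b x - outer u g) < CARD('n)"
  shows "\<exists>b'. degenerate m b' \<and> bb_norm p m (\<lambda>i. b' i - b i)
    \<le> real CARD('n option) * (norm (bb_eval m b x) + real CARD('n option) * (norm g * norm u))"
proof -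
  define N where "N = real CARD('n option)"
  define a where "a i = bb_eval m b x + (g \<bullet> (greville m i - x)) *\<^sub>R u" for i
  define b' where "b' i = b i - a i" for i
  have "bb_eval m b' x = 0" "bb_jac m b' x = bb_jac m b x - outer u g"
    unfolding b'_def a_def bb_eval_diff bb_jac_diff
    by (simp_all add: bb_eval_affine[OF m] bb_jac_affine[OF m])
  then have "degenerate m b'" using x rk unfolding degenerate_def by auto
  moreover have "bb_norm p m (\<lambda>i. b' i - b i) \<le> N * (norm (bb_eval m b x) + N * (norm g * norm u))"
  proof (rule bb_norm_le)
    fix i
    assume i: "i \<in> multi_idx m"
    have ai: "norm (a i) \<le> norm (bb_eval m b x) + N * (norm g * norm u)"
      unfolding a_def N_def by (rule norm_affine_at_greville_le[OF m i x])
    have "pnorm p (b' i - b i) \<le> real CARD('n) * norm (b' i - b i)" by (rule pnorm_le_card_norm[OF p])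
    also have "\<dots> = real CARD('n) * norm (a i)" by (simp add: b'_def)
    also have "\<dots> \<le> N * norm (a i)"
      using card_le_card_option[where 'n='n] unfolding N_def by (rule mult_right_mono) simp
    also have "\<dots> \<le> N * (norm (bb_eval m b x) + N * (norm g * norm u))"
      using ai unfolding N_def by (intro mult_left_mono) auto
    finally show "pnorm p (b' i - b i) \<le> N * (norm (bb_eval m b x) + N * (norm g * norm u))" .
  qed
  ultimately show ?thesis unfolding N_def by blast
qed

lemma exists_degenerate_near:
  fixes b :: "('n::finite option \<Rightarrow> nat) \<Rightarrow> real^'n"
  assumes m: "\<forall>j. m j \<ge> 1" and p: "p \<ge> 1" and x: "x \<in> unit_cube"
    and r: "0 < r" "ereal r \<le> cond_at p m b x"
  shows "\<exists>b'. degenerate m b' \<and> r * bb_norm p m (\<lambda>i. b' i - b i) \<le> 3 * real CARD('n option) ^ 4"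
proof -
  define N where "N = real CARD('n option)"
  define c where "c = bb_eval m b x"
  define A where "A = bb_jac m b x"
  have N: "real CARD('n) \<le> N" "1 \<le> N" unfolding N_def using card_le_card_option by auto
  have rc: "r * norm c \<le> N"
  proof (cases "c = 0")
    case False
    have "r * pnorm p c \<le> 1"
      using r False pnorm_pos[OF p False] unfolding ereal_le_cond_at_iff c_def
      by (simp add: le_divide_eq)
    have "norm c \<le> real CARD('n) * pnorm p c" by (rule norm_le_card_pnorm[OF p])
    also have "\<dots> \<le> N * pnorm p c"
      using N(1) pnorm_nonneg[OF p, of c] by (rule mult_right_mono)
    finally have "r * norm c \<le> N * (r * pnorm p c)"
      using r(1) by (simp add: mult_left_mono mult.left_commute)
    also have "\<dots> \<le> N" using \<open>r * pnorm p c \<le> 1\<close> N(2) by simp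
    finally show ?thesis .
  qed (use N in simp)
  obtain u g where rk: "rank (A - outer u g) < CARD('n)" and gu: "r * (norm g * norm u) \<le> 2 * N ^ 2"
  proof (cases "rank A < CARD('n)")
    case True
    moreover have "outer 0 0 = (0 :: real^'n option^'n)" by (simp add: outer_def vec_eq_iff)
    ultimately show ?thesis using that[of 0 0] by simp
  next
    case False
    then have "r \<le> opnorm p (pinv A)" using r(2) unfolding ereal_le_cond_at_iff A_def by simp
    then obtain u g where "rank (A - outer u g) < CARD('n)"
        "r * (norm g * norm u) \<le> 2 * real CARD('n) * real CARD('n option)"
      using exists_rank_deficient_near[OF p _ r(1)] False unfolding rank_less_card_rows_iff by blast
    moreover have "2 * real CARD('n) * real CARD('n option) \<le> 2 * N ^ 2"
      using N unfolding N_def by (simp add: power2_eq_square)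
    ultimately show ?thesis using that by fastforce
  qed
  obtain b' where b': "degenerate m b'" "bb_norm p m (\<lambda>i. b' i - b i) \<le> N * (norm c + N * (norm g * norm u))"
    using exists_degenerate_affine_correction[OF m p x rk[unfolded A_def]] unfolding N_def c_def by blast
  have "r * bb_norm p m (\<lambda>i. b' i - b i) \<le> N * (r * norm c + N * (r * (norm g * norm u)))"
    using mult_left_mono[OF b'(2), of r] r(1) by (simp add: algebra_simps)
  also have "\<dots> \<le> N * (N + N * (2 * N ^ 2))"
    using rc gu N by (intro mult_left_mono add_mono) auto
  also have "\<dots> = N ^ 2 + 2 * N ^ 4" by (simp add: algebra_simps power2_eq_square power4_eq_xxxx)
  also have "\<dots> \<le> 3 * N ^ 4" using power_increasing[of 2 4 N] N(2) by simp
  finally show ?thesis using b'(1) unfolding N_def by blast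
qed

lemma kappa_eq_bb_norm_mult:
  fixes b :: "('n::finite option \<Rightarrow> nat) \<Rightarrow> real^'n"
  assumes p: "p \<ge> 1" and nd: "\<not> degenerate m b"
  obtains V where "0 < V" "kappa p m b = ereal (bb_norm p m b * V)"
    "\<And>x. x \<in> unit_cube \<Longrightarrow> cond_at p m b x \<le> ereal V"
    "\<exists>x\<in>unit_cube. ereal (V / 2) < cond_at p m b x"
proof -
  define S where "S = (SUP x\<in>unit_cube. cond_at p m b x)"
  have "0 < cond_at p m b 0" by (rule cond_at_pos[OF p])
  also have "\<dots> \<le> S" unfolding S_def by (rule SUP_upper[OF zero_in_unit_cube])
  finally obtain V where V: "S = ereal V" "0 < V"
    using SUP_cond_at_less_top[OF p nd] unfolding S_def[symmetric] by (cases S) auto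
  have "ereal (V / 2) < S" using V by simp
  then have "\<exists>x\<in>unit_cube. ereal (V / 2) < cond_at p m b x" unfolding S_def less_SUP_iff .
  moreover have "cond_at p m b x \<le> ereal V" if "x \<in> unit_cube" for x
    using SUP_upper[OF that, of "cond_at p m b"] V unfolding S_def by simp
  ultimately show ?thesis using that V kappa_eq_SUP_cond_at[of p m b] unfolding S_def by simp
qed

lemma not_degenerate_if_close:
  fixes b b' :: "('n::finite option \<Rightarrow> nat) \<Rightarrow> real^'n"
  assumes p: "p \<ge> 1" and V: "\<And>x. x \<in> unit_cube \<Longrightarrow> cond_at p m b x \<le> ereal V"
    and close: "bb_norm p m (\<lambda>i. b' i - b i) * V \<le> 1 / (2 * (real CARD('n option) ^ 5 * bern_bound m))"
  shows "\<not> degenerate m b'"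
proof
  define K where "K = real CARD('n option) ^ 5 * bern_bound m"
  have K: "0 < K" unfolding K_def using bern_bound_pos[of m] by simp
  assume "degenerate m b'"
  then obtain x where x: "x \<in> unit_cube" "bb_eval m b' x = 0" "rank (bb_jac m b' x) < CARD('n)"
    unfolding degenerate_def by blast
  have "1 \<le> K * (bb_norm p m (\<lambda>i. b' i - b i) * V)"
    using one_le_dist_mult_cond_at[OF p x V[OF x(1)]] unfolding K_def by (simp add: mult_ac)
  also have "\<dots> \<le> 1 / 2" using mult_left_mono[OF close[folded K_def], of K] K by simp
  finally show False by simp
qed

lemma exists_degenerate_within:
  fixes b :: "('n::finite option \<Rightarrow> nat) \<Rightarrow> real^'n"
  assumes m: "\<forall>j. m j \<ge> 1" and p: "p \<ge> 1" and V: "0 < V"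
    and near: "\<exists>x\<in>unit_cube. ereal (V / 2) < cond_at p m b x"
  shows "\<exists>b'. degenerate m b' \<and> bb_norm p m (\<lambda>i. b' i - b i) * V \<le> 6 * real CARD('n option) ^ 4"
proof -
  obtain x where x: "x \<in> unit_cube" "ereal (V / 2) < cond_at p m b x" using near by blast
  obtain b' where "degenerate m b'" "V / 2 * bb_norm p m (\<lambda>i. b' i - b i) \<le> 3 * real CARD('n option) ^ 4"
    using exists_degenerate_near[OF m p x(1), of "V / 2"] x(2) V by force
  then show ?thesis by (auto simp: mult.commute)
qed

lemma ereal_divide_le_divide_mult_iff:
  fixes d a v c :: real
  assumes "0 < a" "0 < v"
  shows "ereal (d / a) \<le> ereal c / ereal (a * v) \<longleftrightarrow> d * v \<le> c"
  using assms by (simp add: field_simps)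

theorem theorem2:
  fixes m :: "'n::finite option \<Rightarrow> nat" and p :: ereal
  assumes "\<forall>j. m j \<ge> 1" and "p \<ge> 1"
  shows "\<exists>c c'. c > 0 \<and> c' > 0 \<and>
    (\<forall>b :: ('n option \<Rightarrow> nat) \<Rightarrow> real^'n. \<not> degenerate m b \<longrightarrow>
       (\<forall>b'. ereal (bb_norm p m (\<lambda>i. b' i - b i) / bb_norm p m b) \<le> ereal c / kappa p m b
               \<longrightarrow> \<not> degenerate m b') \<and>
       (\<exists>b'. degenerate m b' \<and>
               ereal (bb_norm p m (\<lambda>i. b' i - b i) / bb_norm p m b) \<le> ereal c' / kappa p m b))"
proof -
  note m = assms(1) and p = assms(2)
  define N where "N = real CARD('n option)"
  define c where "c = 1 / (2 * (N ^ 5 * bern_bound m))"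
  have "(\<forall>b'. ereal (bb_norm p m (\<lambda>i. b' i - b i) / bb_norm p m b) \<le> ereal c / kappa p m b
               \<longrightarrow> \<not> degenerate m b') \<and>
       (\<exists>b'. degenerate m b' \<and>
               ereal (bb_norm p m (\<lambda>i. b' i - b i) / bb_norm p m b) \<le> ereal (6 * N ^ 4) / kappa p m b)"
    if nd: "\<not> degenerate m b" for b :: "('n option \<Rightarrow> nat) \<Rightarrow> real^'n"
  proof -
    obtain V where V: "0 < V" "kappa p m b = ereal (bb_norm p m b * V)"
      "\<And>x. x \<in> unit_cube \<Longrightarrow> cond_at p m b x \<le> ereal V"
      "\<exists>x\<in>unit_cube. ereal (V / 2) < cond_at p m b x"
      using kappa_eq_bb_norm_mult[OF p nd] by blast
    show ?thesis
      unfolding V(2) ereal_divide_le_divide_mult_iff[OF bb_norm_pos[OF p nd] V(1)] c_def N_def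
      using not_degenerate_if_close[OF p V(3)] exists_degenerate_within[OF m p V(1) V(4)] by blast
  qed
  moreover have "c > 0" "6 * N ^ 4 > 0" unfolding c_def N_def using bern_bound_pos[of m] by simp_all
  ultimately show ?thesis by blast
qed

end
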